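(* Let $A=M_2(\mathbb{C})$, $B=\mathbb{C}I_2$, $\Delta=\{\mathrm{diag}(\lambda,\mu):\lambda,\mu\in\mathbb{C}\}\subset A$, and let $E:A\to B$ be the conditional expectation $E([a_{ij}])=\frac{a_{11}+a_{22}}{2}I_2$. Let $U(2)$ be the group of $2\times 2$ unitary matrices and let $\alpha(\cdot,\cdot)$ denote the interior angle with respect to $E$. Then $$\{\alpha(\Delta,u\Delta u^* ): u\in U(2)\}=\left[0,\tfrac{\pi}{2}\right].$$
   Context: Let $B\subset A$ be an inclusion of unital $C^*$-algebras (common unit). A conditional expectation $E:A\to B$ has finite index if there is a finite set $\{\lambda_1,\dots,\lambda_n\}\subset A$ (a quasi-basis) with $x=\sum_i E(x\lambda_i)\lambda_i^*=\sum_i\lambda_iE(\lambda_i^*x)$ for all $x\in A$; its Watatani index is $\mathrm{Ind}(E)=\sum_i\lambda_i\lambda_i^*$, a positive invertible central element of $A$ independent of the quasi-basis. $\mathrm{IMS}(B,A,E)$ is the set of intermediate $C^*$-subalgebras $B\subset C\subset A$ admitting a conditional expectation $F:A\to C$ with $E=E_{\restriction_C}\circ F$ (such compatible $F$ is unique and of finite index). For $E$ of finite index, $A$ is a Hilbert $B$-module with $\langle a,a'\rangle_B=E(a^*a')$; $A\subset\mathcal{L}_B(A)$ (adjointable operators) by left multiplication; the Jones projection $e_B\in\mathcal{L}_B(A)$ is $e_B(a)=E(a)$; the $C^*$-basic construction is the unital $C^*$-algebra $A_1=\mathrm{span}\{xe_By:x,y\in A\}$; the dual conditional expectation $E_1:A_1\to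 A$ satisfies $E_1(xe_By)=\mathrm{Ind}(E)^{-1}xy$. For $C\in\mathrm{IMS}(B,A,E)$ with compatible $F$, the Jones projection $e_C$, $e_C(a)=F(a)$, belongs to $A_1$. Put $\langle x,y\rangle_A=E_1(x^*y)$ and $\|x\|_{A_1}=\|E_1(x^*x)\|^{1/2}$ for $x,y\in A_1$. For $C,D\in\mathrm{IMS}(B,A,E)\setminus\{B\}$ the interior angle $\alpha(C,D)\in[0,\frac{\pi}{2}]$ is defined by $$\cos(\alpha(C,D))=\frac{\|\langle e_C-e_B,e_D-e_B\rangle_A\|}{\|e_C-e_B\|_{A_1}\|e_D-e_B\|_{A_1}}.$$ In the present setting $E$ has finite index, $\Delta\in\mathrm{IMS}(B,A,E)$ with compatible conditional expectation $F([a_{ij}])=\mathrm{diag}(a_{11},a_{22})$, and for $u\in U(2)$, $u\Delta u^*\in\mathrm{IMS}(B,A,E)$ with compatible conditional expectation $F_u(a)=uF(u^*au)u^*$. *)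

theory Defs
  imports "HOL-Analysis.Analysis"
begin

text \<open>
  Unital inclusions \<open>B \<subseteq> C \<subseteq> A\<close> of C*-algebras with ambient algebra \<open>A = M\<^sub>n(\<complex>)\<close>, where \<open>A\<close> is the
  whole type \<open>complex^'n^'n\<close>. Its C*-algebra structure is matrix multiplication \<open>**\<close>, the entrywise
  scalar action \<open>cscale\<close>, the conjugate transpose \<open>dagger\<close> and the operator norm \<open>opnorm\<close>; the
  type class operations \<open>*\<close> and \<open>norm\<close> are the componentwise product and the Hilbert--Schmidt norm,
  and are not used.
\<close>

type_synonym 'n cmat = "complex^'n^'n"

definition cscale :: "complex \<Rightarrow> 'n cmat \<Rightarrow> 'n::finite cmat" where
  "cscale c a = (\<chi> i j. c * a $ i $ j)"

definition dagger :: "'n cmat \<Rightarrow> 'n::finite cmat" where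
  "dagger a = (\<chi> i j. cnj (a $ j $ i))"

definition opnorm :: "'n::finite cmat \<Rightarrow> real" where
  "opnorm a = onorm (\<lambda>v. a *v v)"

definition unitary_mats :: "'n::finite cmat set" where
  "unitary_mats = {u. dagger u ** u = mat 1 \<and> u ** dagger u = mat 1}"

text \<open>Closedness refers to the type class topology, which is the norm topology of \<open>opnorm\<close> since
  all norms on \<open>M\<^sub>n(\<complex>)\<close> are equivalent.\<close>

definition unital_cstar_subalgebra :: "'n::finite cmat set \<Rightarrow> bool" where
  "unital_cstar_subalgebra C \<longleftrightarrow>
     mat 1 \<in> C \<and>
     (\<forall>a\<in>C. \<forall>b\<in>C. a + b \<in> C \<and> a ** b \<in> C) \<and>
     (\<forall>c. \<forall>a\<in>C. cscale c a \<in> C) \<and>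
     (\<forall>a\<in>C. dagger a \<in> C) \<and>
     closed C"

text \<open>A conditional expectation \<open>F : A \<rightarrow> C\<close>: a linear, positive, \<open>C\<close>-bimodular projection onto \<open>C\<close>.
  Positivity is that \<open>F(a\<^sup>*a)\<close> is again of the form \<open>y\<^sup>*y\<close>.\<close>

definition cond_expectation :: "'n::finite cmat set \<Rightarrow> ('n cmat \<Rightarrow> 'n cmat) \<Rightarrow> bool" where
  "cond_expectation C F \<longleftrightarrow>
     (\<forall>a b. F (a + b) = F a + F b) \<and>
     (\<forall>c a. F (cscale c a) = cscale c (F a)) \<and>
     (\<forall>a. F a \<in> C) \<and>
     (\<forall>a\<in>C. F a = a) \<and>
     (\<forall>c\<in>C. \<forall>d\<in>C. \<forall>a. F (c ** a ** d) = c ** F a ** d) \<and>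
     (\<forall>a. \<exists>y. F (dagger a ** a) = dagger y ** y)"

definition quasi_basis :: "('n::finite cmat \<Rightarrow> 'n cmat) \<Rightarrow> 'n cmat set \<Rightarrow> bool" where
  "quasi_basis E \<Lambda> \<longleftrightarrow> finite \<Lambda> \<and>
     (\<forall>x. x = (\<Sum>l\<in>\<Lambda>. E (x ** l) ** dagger l) \<and> x = (\<Sum>l\<in>\<Lambda>. l ** E (dagger l ** x)))"

definition finite_index :: "('n::finite cmat \<Rightarrow> 'n cmat) \<Rightarrow> bool" where
  "finite_index E \<longleftrightarrow> (\<exists>\<Lambda>. quasi_basis E \<Lambda>)"

definition watatani_index :: "('n::finite cmat \<Rightarrow> 'n cmat) \<Rightarrow> 'n cmat" where
  "watatani_index E = (THE c. \<exists>\<Lambda>. quasi_basis E \<Lambda> \<and> c = (\<Sum>l\<in>\<Lambda>. l ** dagger l))"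

definition compatible :: "('n::finite cmat \<Rightarrow> 'n cmat) \<Rightarrow> 'n cmat set \<Rightarrow> ('n cmat \<Rightarrow> 'n cmat) \<Rightarrow> bool" where
  "compatible E C F \<longleftrightarrow> cond_expectation C F \<and> (\<forall>a. E (F a) = E a)"

definition IMS :: "'n::finite cmat set \<Rightarrow> ('n cmat \<Rightarrow> 'n cmat) \<Rightarrow> 'n cmat set set" where
  "IMS B E = {C. unital_cstar_subalgebra C \<and> B \<subseteq> C \<and> (\<exists>F. compatible E C F)}"

text \<open>From here on, \<open>E\<close> is a conditional expectation of finite index onto a subalgebra \<open>B\<close>. Since
  \<open>B\<close> is the range of \<open>E\<close>, it is not passed as a separate argument. Operators on the Hilbert
  \<open>B\<close>-module \<open>A\<close> are functions on \<open>'n cmat\<close>, with composition as product.\<close>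

definition module_ip :: "('n::finite cmat \<Rightarrow> 'n cmat) \<Rightarrow> 'n cmat \<Rightarrow> 'n cmat \<Rightarrow> 'n cmat" where
  "module_ip E a b = E (dagger a ** b)"

definition module_adj :: "('n::finite cmat \<Rightarrow> 'n cmat) \<Rightarrow> ('n cmat \<Rightarrow> 'n cmat) \<Rightarrow> 'n cmat \<Rightarrow> 'n cmat" where
  "module_adj E T = (THE S. \<forall>a b. module_ip E (T a) b = module_ip E a (S b))"

definition jones_projection :: "('n::finite cmat \<Rightarrow> 'n cmat) \<Rightarrow> 'n cmat set \<Rightarrow> 'n cmat \<Rightarrow> 'n cmat" where
  "jones_projection E C a = (THE F. compatible E C F) a"

text \<open>The operator \<open>\<Sum>\<^sub>k x\<^sub>k e\<^sub>B y\<^sub>k\<close> for a list of pairs \<open>(x\<^sub>k, y\<^sub>k)\<close>, where \<open>e\<^sub>B(a) = E(a)\<close>. Scalar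
  coefficients are absorbed by the \<open>x\<^sub>k\<close>, so these operators form the complex span of all
  \<open>x e\<^sub>B y\<close>.\<close>

definition span_op :: "('n::finite cmat \<Rightarrow> 'n cmat) \<Rightarrow> ('n cmat \<times> 'n cmat) list \<Rightarrow> 'n cmat \<Rightarrow> 'n cmat" where
  "span_op E xys a = (\<Sum>(x, y)\<leftarrow>xys. x ** E (y ** a))"

definition basic_construction :: "('n::finite cmat \<Rightarrow> 'n cmat) \<Rightarrow> ('n cmat \<Rightarrow> 'n cmat) set" where
  "basic_construction E = range (span_op E)"

text \<open>The linear extension to \<open>A\<^sub>1\<close> of \<open>E\<^sub>1(x e\<^sub>B y) = Ind(E)\<^sup>-\<^sup>1 x y\<close>; see \<open>dual_expectation_span_op\<close>
  below for well-definedness. Values outside \<open>A\<^sub>1\<close> are irrelevant.\<close>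

definition dual_expectation :: "('n::finite cmat \<Rightarrow> 'n cmat) \<Rightarrow> ('n cmat \<Rightarrow> 'n cmat) \<Rightarrow> 'n cmat" where
  "dual_expectation E T =
     (THE a. \<exists>xys. T = span_op E xys \<and>
        a = matrix_inv (watatani_index E) ** (\<Sum>(x, y)\<leftarrow>xys. x ** y))"

definition A1_ip :: "('n::finite cmat \<Rightarrow> 'n cmat) \<Rightarrow> ('n cmat \<Rightarrow> 'n cmat) \<Rightarrow> ('n cmat \<Rightarrow> 'n cmat) \<Rightarrow> 'n cmat" where
  "A1_ip E S T = dual_expectation E (module_adj E S \<circ> T)"

definition A1_norm :: "('n::finite cmat \<Rightarrow> 'n cmat) \<Rightarrow> ('n cmat \<Rightarrow> 'n cmat) \<Rightarrow> real" where
  "A1_norm E T = sqrt (opnorm (A1_ip E T T))"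

text \<open>The quotient lies in \<open>[0, 1]\<close> for \<open>C, D\<close> in \<open>IMS B E - {B}\<close>, so the value of \<open>arccos\<close> is the
  angle in \<open>[0, \<pi>/2]\<close> with that cosine.\<close>

definition interior_angle :: "('n::finite cmat \<Rightarrow> 'n cmat) \<Rightarrow> 'n cmat set \<Rightarrow> 'n cmat set \<Rightarrow> real" where
  "interior_angle E C D =
     (let S = (\<lambda>a. jones_projection E C a - E a);
          T = (\<lambda>a. jones_projection E D a - E a)
      in arccos (opnorm (A1_ip E S T) / (A1_norm E S * A1_norm E T)))"

definition scalar_mats :: "2 cmat set" where
  "scalar_mats = {mat c | c. True}"

definition diag2 :: "complex \<Rightarrow> complex \<Rightarrow> 2 cmat" where
  "diag2 l m = vector [vector [l, 0], vector [0, m]]"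

definition Delta :: "2 cmat set" where
  "Delta = {diag2 l m | l m. True}"

definition tr_expectation :: "2 cmat \<Rightarrow> 2 cmat" where
  "tr_expectation a = mat ((a $ 1 $ 1 + a $ 2 $ 2) / 2)"

definition conj_set :: "'n::finite cmat \<Rightarrow> 'n cmat set \<Rightarrow> 'n cmat set" where
  "conj_set u C = (\<lambda>a. u ** a ** dagger u) ` C"


subsection \<open>Well-definedness\<close>

lemma dagger_mult: "dagger (a ** b) = dagger b ** dagger a"
  by (simp add: dagger_def matrix_matrix_mult_def vec_eq_iff mult.commute)

lemma dagger_dagger [simp]: "dagger (dagger a) = a"
  by (simp add: dagger_def vec_eq_iff)

lemma cmat_add_right: "(a + b) ** (c :: 'n::finite cmat) = a ** c + b ** c"
  by (simp add: matrix_matrix_mult_def vec_eq_iff distrib_right sum.distrib)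

lemma cmat_sum_left: "(\<Sum>i\<in>I. f i) ** (c :: 'n::finite cmat) = (\<Sum>i\<in>I. f i ** c)"
  by (induction I rule: infinite_finite_induct) (auto simp: cmat_add_right)

lemma cmat_sum_right: "(c :: 'n::finite cmat) ** (\<Sum>i\<in>I. f i) = (\<Sum>i\<in>I. c ** f i)"
  by (induction I rule: infinite_finite_induct) (auto simp: matrix_add_ldistrib)

lemma quasi_basis_left: "quasi_basis E \<Lambda> \<Longrightarrow> (\<Sum>l\<in>\<Lambda>. E (x ** l) ** dagger l) = x"
  and quasi_basis_right: "quasi_basis E \<Lambda> \<Longrightarrow> (\<Sum>l\<in>\<Lambda>. l ** E (dagger l ** x)) = x"
  by (simp_all only: quasi_basis_def)

lemma quasi_basis_index_unique:
  assumes "quasi_basis E \<Lambda>" "quasi_basis E M"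
  shows "(\<Sum>l\<in>\<Lambda>. l ** dagger l) = (\<Sum>m\<in>M. m ** dagger m)"
proof -
  have "(\<Sum>l\<in>\<Lambda>. l ** dagger l) = (\<Sum>l\<in>\<Lambda>. (\<Sum>m\<in>M. m ** E (dagger m ** l)) ** dagger l)"
    by (simp only: quasi_basis_right[OF assms(2)])
  also have "\<dots> = (\<Sum>l\<in>\<Lambda>. \<Sum>m\<in>M. m ** (E (dagger m ** l) ** dagger l))"
    by (simp only: cmat_sum_left matrix_mul_assoc)
  also have "\<dots> = (\<Sum>m\<in>M. \<Sum>l\<in>\<Lambda>. m ** (E (dagger m ** l) ** dagger l))"
    by (rule sum.swap)
  also have "\<dots> = (\<Sum>m\<in>M. m ** dagger m)"
    by (simp only: cmat_sum_right[symmetric] quasi_basis_left[OF assms(1)])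
  finally show ?thesis .
qed

lemma watatani_index_eq:
  assumes "quasi_basis E \<Lambda>"
  shows "watatani_index E = (\<Sum>l\<in>\<Lambda>. l ** dagger l)"
  unfolding watatani_index_def
proof (rule the_equality)
  show "\<exists>M. quasi_basis E M \<and> (\<Sum>l\<in>\<Lambda>. l ** dagger l) = (\<Sum>m\<in>M. m ** dagger m)"
    using assms by blast
next
  fix c assume "\<exists>M. quasi_basis E M \<and> c = (\<Sum>m\<in>M. m ** dagger m)"
  then obtain M where M: "quasi_basis E M" "c = (\<Sum>m\<in>M. m ** dagger m)"
    by blast
  show "c = (\<Sum>l\<in>\<Lambda>. l ** dagger l)"
    unfolding M(2) by (rule quasi_basis_index_unique[OF M(1) assms])
qed

lemma span_op_quasi_basis:
  assumes "quasi_basis E \<Lambda>"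
  shows "(\<Sum>l\<in>\<Lambda>. span_op E xys l ** dagger l) = (\<Sum>(x, y)\<leftarrow>xys. x ** y)"
proof (induction xys)
  case Nil
  then show ?case by (simp add: span_op_def)
next
  case (Cons p xys)
  obtain x y where p: "p = (x, y)" by force
  have "(\<Sum>l\<in>\<Lambda>. x ** E (y ** l) ** dagger l) = x ** (\<Sum>l\<in>\<Lambda>. E (y ** l) ** dagger l)"
    by (simp only: cmat_sum_right matrix_mul_assoc)
  also have "\<dots> = x ** y"
    by (simp only: quasi_basis_left[OF assms])
  finally show ?case
    using Cons by (simp add: p span_op_def cmat_add_right sum.distrib)
qed

lemma dual_expectation_span_op:
  assumes "finite_index E"
  shows "dual_expectation E (span_op E xys) =
           matrix_inv (watatani_index E) ** (\<Sum>(x, y)\<leftarrow>xys. x ** y)"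
  unfolding dual_expectation_def
proof (rule the_equality)
  fix a
  assume "\<exists>zs. span_op E xys = span_op E zs \<and>
            a = matrix_inv (watatani_index E) ** (\<Sum>(x, y)\<leftarrow>zs. x ** y)"
  then obtain zs where zs: "span_op E xys = span_op E zs"
    and a: "a = matrix_inv (watatani_index E) ** (\<Sum>(x, y)\<leftarrow>zs. x ** y)"
    by blast
  obtain \<Lambda> where "quasi_basis E \<Lambda>"
    using assms by (auto simp: finite_index_def)
  from span_op_quasi_basis[OF this, of xys] span_op_quasi_basis[OF this, of zs]
  show "a = matrix_inv (watatani_index E) ** (\<Sum>(x, y)\<leftarrow>xys. x ** y)"
    by (simp only: a zs)
qed blast

lemma cmat_cscale: "cscale c a ** (b :: 'n::finite cmat) = cscale c (a ** b)"
     "a ** cscale c b = cscale c (a ** (b :: 'n::finite cmat))"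
  by (simp_all add: cscale_def matrix_matrix_mult_def vec_eq_iff sum_distrib_left mult_ac)

lemma dagger_add: "dagger (a + b) = dagger a + dagger b"
  by (simp add: dagger_def vec_eq_iff)

lemma dagger_cscale: "dagger (cscale c a) = cscale (cnj c) (dagger a)"
  by (simp add: dagger_def cscale_def vec_eq_iff)

text \<open>The standing facts about the example: \<open>tr_expectation\<close> has finite index, and each
  \<open>u \<Delta> u\<^sup>*\<close> (with \<open>u = 1\<close> giving \<open>\<Delta>\<close>) is an intermediate algebra other than \<open>B\<close>, with unique
  compatible conditional expectation \<open>diag_expectation u\<close>.\<close>

lemma Delta_iff: "a \<in> Delta \<longleftrightarrow> a $ 1 $ 2 = 0 \<and> a $ 2 $ 1 = 0"
  by (auto simp: Delta_def diag2_def vec_eq_iff forall_2)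

lemma scalar_iff: "a \<in> scalar_mats \<longleftrightarrow> a $ 1 $ 2 = 0 \<and> a $ 2 $ 1 = 0 \<and> a $ 1 $ 1 = a $ 2 $ 2"
  by (auto simp: scalar_mats_def mat_def vec_eq_iff forall_2)

lemma tr_cond_expectation: "cond_expectation scalar_mats tr_expectation"
proof -
  have "\<exists>y. tr_expectation (dagger a ** a) = dagger y ** y" for a
  proof -
    define s where "s = (norm (a$1$1))\<^sup>2 + (norm (a$1$2))\<^sup>2 + (norm (a$2$1))\<^sup>2 + (norm (a$2$2))\<^sup>2"
    have s: "s \<ge> 0" by (simp add: s_def)
    have "complex_of_real s = cnj (a$1$1) * a$1$1 + cnj (a$1$2) * a$1$2 + cnj (a$2$1) * a$2$1 + cnj (a$2$2) * a$2$2"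
      by (simp add: s_def complex_norm_square mult.commute del: of_real_power)
    moreover have "complex_of_real (sqrt (s/2)) * complex_of_real (sqrt (s/2)) = complex_of_real s / 2"
      using s by (simp flip: of_real_mult)
    ultimately have "tr_expectation (dagger a ** a) = dagger (mat (complex_of_real (sqrt (s/2)))) ** mat (complex_of_real (sqrt (s/2)))"
      by (simp add: tr_expectation_def mat_def dagger_def matrix_matrix_mult_def vec_eq_iff forall_2 sum_2 algebra_simps)
    then show ?thesis by blast
  qed
  moreover have "tr_expectation (c ** a ** d) = c ** tr_expectation a ** d"
    if cd: "c \<in> scalar_mats" "d \<in> scalar_mats" for a c d
  proof -
    obtain k l where "c = mat k" "d = mat l"
      using cd by (auto simp: scalar_mats_def)
    then show ?thesis
      by (simp add: tr_expectation_def mat_def matrix_matrix_mult_def vec_eq_iff forall_2 sum_2 field_simps)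
  qed
  moreover have "tr_expectation a = a" if "a \<in> scalar_mats" for a
    using that by (simp add: scalar_iff tr_expectation_def mat_def vec_eq_iff forall_2)
  moreover have "tr_expectation a \<in> scalar_mats" for a
    by (auto simp: scalar_mats_def tr_expectation_def)
  moreover have "tr_expectation (a + b) = tr_expectation a + tr_expectation b" for a b
    by (simp add: tr_expectation_def mat_def vec_eq_iff forall_2 field_simps)
  moreover have "tr_expectation (cscale c a) = cscale c (tr_expectation a)" for c a
    by (simp add: tr_expectation_def mat_def cscale_def vec_eq_iff forall_2 field_simps)
  ultimately show ?thesis
    unfolding cond_expectation_def by blast
qed

lemma tr_quasi_basis:
  "quasi_basis tr_expectation
     ((\<lambda>(i, j). (\<chi> k l. if k = i \<and> l = j then complex_of_real (sqrt 2) else 0)) ` UNIV)"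
proof -
  define s where "s = complex_of_real (sqrt 2)"
  define f :: "2 \<times> 2 \<Rightarrow> 2 cmat" where "f = (\<lambda>(i, j). (\<chi> k l. if k = i \<and> l = j then s else 0))"
  have s: "s * s = 2" "s \<noteq> 0" "cnj s = s"
    by (simp_all add: s_def flip: of_real_mult)
  have s2: "s * x / 2 * s = x" "s * (s * x / 2) = x" "x * s / 2 * s = x" for x
    using s(1) by (auto simp: field_simps)
  have inj: "inj f"
  proof (rule injI)
    fix p q assume "f p = f q"
    moreover have "f p $ fst p $ snd p = s"
      by (simp add: f_def case_prod_unfold)
    ultimately have "f q $ fst p $ snd p = s"
      by simp
    then show "p = q"
      using s(2) by (auto simp: f_def case_prod_unfold prod_eq_iff split: if_splits)
  qed
  have U: "sum g (UNIV :: (2 \<times> 2) set) = g (1,1) + g (1,2) + g (2,1) + g (2,2)" for g :: "_ \<Rightarrow> 2 cmat"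
  proof -
    have "sum g UNIV = (\<Sum>i\<in>UNIV. \<Sum>j\<in>UNIV. g (i, j))"
      by (simp add: sum.cartesian_product flip: UNIV_Times_UNIV)
    then show ?thesis by (simp add: sum_2 add.assoc)
  qed
  have "quasi_basis tr_expectation (f ` UNIV)"
    unfolding quasi_basis_def sum.reindex[OF inj] o_def U
    by (simp add: f_def tr_expectation_def mat_def dagger_def matrix_matrix_mult_def vec_eq_iff forall_2 sum_2 s s2)
  then show ?thesis unfolding f_def s_def .
qed

lemma tr_finite_index: "finite_index tr_expectation"
  using tr_quasi_basis unfolding finite_index_def by blast

text \<open>\<open>diag_expectation u a = u F(u\<^sup>*au) u\<^sup>*\<close>, where \<open>F\<close> keeps the diagonal of a matrix.\<close>

definition diag_expectation :: "2 cmat \<Rightarrow> 2 cmat \<Rightarrow> 2 cmat" where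
  "diag_expectation u a =
     (let b = dagger u ** a ** u in u ** diag2 (b $ 1 $ 1) (b $ 2 $ 2) ** dagger u)"

lemma conj_set_iff:
  assumes "u \<in> unitary_mats"
  shows "a \<in> conj_set u C \<longleftrightarrow> dagger u ** a ** u \<in> C"
proof -
  have u: "dagger u ** u = mat 1" "u ** dagger u = mat 1"
    using assms by (auto simp: unitary_mats_def)
  have 1: "u ** (dagger u ** a ** u) ** dagger u = a"
    by (metis u matrix_mul_assoc matrix_mul_lid matrix_mul_rid)
  have 2: "dagger u ** (u ** b ** dagger u) ** u = b" for b
    by (metis u matrix_mul_assoc matrix_mul_lid matrix_mul_rid)
  show ?thesis
    unfolding conj_set_def using 1 2 by (metis (no_types, lifting) image_iff)
qed

lemma Delta_subalgebra: "unital_cstar_subalgebra Delta"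
proof -
  have "Delta = {a. a $ 1 $ 2 = 0} \<inter> {a. a $ 2 $ 1 = 0}"
    using Delta_iff by blast
  moreover have "closed ({a::2 cmat. a $ 1 $ 2 = 0} \<inter> {a. a $ 2 $ 1 = 0})"
    by (intro closed_Int closed_Collect_eq continuous_intros)
  ultimately show ?thesis
    by (auto simp: unital_cstar_subalgebra_def Delta_iff mat_def cscale_def dagger_def matrix_matrix_mult_def sum_2)
qed

lemma conj_subalgebra:
  assumes "u \<in> unitary_mats" "unital_cstar_subalgebra C"
  shows "unital_cstar_subalgebra (conj_set u C)"
proof -
  have u: "dagger u ** u = mat 1" "u ** dagger u = mat 1"
    using assms by (auto simp: unitary_mats_def)
  have "conj_set u C = (\<lambda>a. dagger u ** a ** u) -` C"
    using conj_set_iff[OF assms(1)] by blast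
  moreover have "closed ((\<lambda>a. dagger u ** a ** u) -` C)"
  proof (rule closed_vimage)
    show "closed C" using assms(2) by (simp add: unital_cstar_subalgebra_def)
    have "continuous_on UNIV (\<lambda>a. dagger u ** a ** u)"
      unfolding matrix_matrix_mult_def by (intro continuous_intros)
    then show "continuous_on UNIV (\<lambda>a. dagger u ** a ** u)" .
  qed
  ultimately have "closed (conj_set u C)" by simp
  moreover have "a ** b \<in> conj_set u C" if "a \<in> conj_set u C" "b \<in> conj_set u C" for a b
  proof -
    have "dagger u ** (a ** b) ** u = (dagger u ** a ** u) ** (dagger u ** b ** u)"
      by (metis u(2) matrix_mul_assoc matrix_mul_rid)
    then show ?thesis
      using that assms by (simp add: conj_set_iff unital_cstar_subalgebra_def)
  qed
  moreover have "dagger a \<in> conj_set u C" if "a \<in> conj_set u C" for a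
  proof -
    have "dagger u ** dagger a ** u = dagger (dagger u ** a ** u)"
      by (simp add: dagger_mult matrix_mul_assoc)
    then show ?thesis
      using that assms by (simp add: conj_set_iff unital_cstar_subalgebra_def)
  qed
  ultimately show ?thesis
    using assms u
    by (simp add: unital_cstar_subalgebra_def conj_set_iff cmat_cscale cmat_add_right matrix_add_ldistrib)
qed

lemma diag_expectation_compatible:
  assumes "u \<in> unitary_mats"
  shows "compatible tr_expectation (conj_set u Delta) (diag_expectation u)"
proof -
  have u: "dagger u ** u = mat 1" "u ** dagger u = mat 1"
    using assms by (auto simp: unitary_mats_def)
  define G where "G b = diag2 (b $ 1 $ 1) (b $ 2 $ 2)" for b :: "2 cmat"
  define c where "c a = dagger u ** a ** u" for a
  define d where "d a = u ** a ** dagger u" for a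
  have F: "diag_expectation u a = d (G (c a))" for a
    by (simp add: diag_expectation_def Let_def c_def d_def G_def)
  have cd: "c (d a) = a" and dc: "d (c a) = a" for a
    unfolding c_def d_def by (metis u matrix_mul_assoc matrix_mul_lid matrix_mul_rid)+
  have cm: "c (a ** b) = c a ** c b" and dm: "d (a ** b) = d a ** d b" for a b
    unfolding c_def d_def by (metis u matrix_mul_assoc matrix_mul_rid)+
  have cdag: "c (dagger a) = dagger (c a)" and ddag: "d (dagger a) = dagger (d a)" for a
    by (simp_all add: c_def d_def dagger_mult matrix_mul_assoc)
  have ca: "c (a + b) = c a + c b" and da: "d (a + b) = d a + d b" for a b
    by (simp_all add: c_def d_def cmat_add_right matrix_add_ldistrib)
  have cs: "c (cscale k a) = cscale k (c a)" and ds: "d (cscale k a) = cscale k (d a)" for k a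
    by (simp_all add: c_def d_def cmat_cscale)
  have G: "G (a + b) = G a + G b" "G (cscale k a) = cscale k (G a)" "G a \<in> Delta"
    "a \<in> Delta \<Longrightarrow> G a = a" "a \<in> Delta \<Longrightarrow> b \<in> Delta \<Longrightarrow> G (a ** x ** b) = a ** G x ** b" for a b k x
    by (auto simp: G_def Delta_iff diag2_def cscale_def matrix_matrix_mult_def vec_eq_iff forall_2 sum_2)
  have Gpos: "\<exists>y. G (dagger a ** a) = dagger y ** y" for a
  proof -
    define s where "s i = (norm (a$1$i))\<^sup>2 + (norm (a$2$i))\<^sup>2" for i
    have s: "s i \<ge> 0" for i by (simp add: s_def)
    have 1: "complex_of_real (s i) = cnj (a$1$i) * a$1$i + cnj (a$2$i) * a$2$i" for i
      by (simp add: s_def complex_norm_square mult.commute del: of_real_power)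
    have 2: "complex_of_real (sqrt (s i)) * complex_of_real (sqrt (s i)) = complex_of_real (s i)" for i
      using s by (simp flip: of_real_mult)
    have "G (dagger a ** a) = dagger (diag2 (sqrt (s 1)) (sqrt (s 2))) ** diag2 (sqrt (s 1)) (sqrt (s 2))"
      by (simp add: G_def diag2_def dagger_def matrix_matrix_mult_def vec_eq_iff forall_2 sum_2 1 2)
    then show ?thesis by blast
  qed
  have pos: "\<exists>y. d (G (c (dagger a ** a))) = dagger y ** y" for a
    using Gpos[of "c a"] by (metis cm cdag dm ddag)
  have mem: "a \<in> conj_set u Delta \<longleftrightarrow> c a \<in> Delta" for a
    using conj_set_iff[OF assms] by (simp add: c_def)
  have tr: "tr_expectation (x ** y) = tr_expectation (y ** x)" for x y
    by (simp add: tr_expectation_def matrix_matrix_mult_def sum_2 algebra_simps)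
  have trd: "tr_expectation (d a) = tr_expectation a" for a
    unfolding d_def using tr[of "u ** a" "dagger u"] u by (simp add: matrix_mul_assoc)
  have trG: "tr_expectation (G a) = tr_expectation a" for a
    by (simp add: tr_expectation_def G_def diag2_def)
  show ?thesis
    unfolding compatible_def cond_expectation_def F
  proof (intro conjI allI ballI)
    fix a b k
    show "d (G (c (a + b))) = d (G (c a)) + d (G (c b))" by (simp only: ca da G(1))
    show "d (G (c (cscale k a))) = cscale k (d (G (c a)))" by (simp only: cs ds G(2))
    show "d (G (c a)) \<in> conj_set u Delta" by (simp only: mem cd G(3))
    show "\<exists>y. d (G (c (dagger a ** a))) = dagger y ** y" by (rule pos)
    show "tr_expectation (d (G (c a))) = tr_expectation a" by (metis trd trG dc)
  next
    fix a assume "a \<in> conj_set u Delta"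
    then show "d (G (c a)) = a" by (simp only: mem dc G(4))
  next
    fix x y a assume "x \<in> conj_set u Delta" "y \<in> conj_set u Delta"
    then show "d (G (c (x ** a ** y))) = x ** d (G (c a)) ** y"
      by (simp only: mem cm dm dc G(5))
  qed
qed

lemma conj_Delta_IMS:
  assumes "u \<in> unitary_mats"
  shows "conj_set u Delta \<in> IMS scalar_mats tr_expectation - {scalar_mats}"
proof -
  have u: "dagger u ** u = mat 1" "u ** dagger u = mat 1"
    using assms by (auto simp: unitary_mats_def)
  have "mat k = cscale k (mat 1 :: 2 cmat)" for k
    by (simp add: mat_def cscale_def vec_eq_iff)
  then have sc: "dagger u ** mat k ** u = mat k" "u ** mat k ** dagger u = mat k" for k
    by (metis cmat_cscale matrix_mul_rid u)+
  have "scalar_mats \<subseteq> conj_set u Delta"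
    by (auto simp: scalar_mats_def conj_set_iff[OF assms] sc) (simp add: Delta_iff mat_def)
  moreover have "conj_set u Delta \<noteq> scalar_mats"
  proof
    assume "conj_set u Delta = scalar_mats"
    moreover have "u ** diag2 1 0 ** dagger u \<in> conj_set u Delta"
      by (auto simp: conj_set_def Delta_def)
    ultimately obtain k where "u ** diag2 1 0 ** dagger u = mat k"
      by (auto simp: scalar_mats_def)
    then have "diag2 1 0 = mat k"
      by (metis sc(1) u(1) matrix_mul_assoc matrix_mul_lid matrix_mul_rid)
    then show False
      by (auto simp: diag2_def mat_def vec_eq_iff forall_2)
  qed
  ultimately show ?thesis
    using conj_subalgebra[OF assms Delta_subalgebra] diag_expectation_compatible[OF assms]
    by (auto simp: IMS_def)
qed

lemma tr_faithful:
  assumes "tr_expectation (dagger a ** a) = 0"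
  shows "a = 0"
proof -
  have "tr_expectation (dagger a ** a) $ 1 $ 1 = 0" using assms by simp
  then have "complex_of_real ((norm (a$1$1))\<^sup>2 + (norm (a$1$2))\<^sup>2 + (norm (a$2$1))\<^sup>2 + (norm (a$2$2))\<^sup>2) = 0"
    by (simp add: tr_expectation_def mat_def dagger_def matrix_matrix_mult_def sum_2 complex_norm_square mult.commute add.commute add.left_commute del: of_real_power)
  then have "(norm (a$1$1))\<^sup>2 + (norm (a$1$2))\<^sup>2 + (norm (a$2$1))\<^sup>2 + (norm (a$2$2))\<^sup>2 = 0"
    using of_real_eq_0_iff by blast
  then show ?thesis
    by (simp add: vec_eq_iff forall_2 add_nonneg_eq_0_iff)
qed

lemma tr_compatible_unique:
  assumes "unital_cstar_subalgebra C" "compatible tr_expectation C F" "compatible tr_expectation C F'"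
  shows "F = F'"
proof
  fix a
  let ?x = "F a - F' a"
  note C = assms(1)[unfolded unital_cstar_subalgebra_def]
  have b: "tr_expectation (c ** G a) = tr_expectation (c ** a)"
    if "c \<in> C" "compatible tr_expectation C G" for c G
  proof -
    have "G (c ** a ** mat 1) = c ** G a ** mat 1"
      using that C unfolding compatible_def cond_expectation_def by blast
    then have "G (c ** a) = c ** G a" by simp
    moreover have "tr_expectation (G (c ** a)) = tr_expectation (c ** a)"
      using that(2) unfolding compatible_def by blast
    ultimately show ?thesis by simp
  qed
  have "?x = F a + cscale (-1) (F' a)"
    by (simp add: cscale_def vec_eq_iff)
  then have "?x \<in> C"
    using assms(2,3) C unfolding compatible_def cond_expectation_def by metis
  then have d: "dagger ?x \<in> C" using C by blast
  have "tr_expectation (dagger ?x ** ?x) = tr_expectation (dagger ?x ** F a) - tr_expectation (dagger ?x ** F' a)"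
    by (simp add: tr_expectation_def mat_def matrix_matrix_mult_def vec_eq_iff sum_2 field_simps)
  also have "\<dots> = 0" using b d assms by simp
  finally have "?x = 0" by (rule tr_faithful)
  then show "F a = F' a" by simp
qed

lemma jones_projection_conj_Delta:
  assumes "u \<in> unitary_mats"
  shows "jones_projection tr_expectation (conj_set u Delta) = diag_expectation u"
proof -
  have "(THE F. compatible tr_expectation (conj_set u Delta) F) = diag_expectation u"
    using diag_expectation_compatible[OF assms] tr_compatible_unique
      conj_subalgebra[OF assms Delta_subalgebra] by blast
  then show ?thesis by (auto simp: jones_projection_def)
qed

lemma conj_set_one: "conj_set (mat 1) C = C"
proof -
  have "dagger (mat 1) = (mat 1 :: 'a::finite cmat)"
    by (simp add: dagger_def mat_def vec_eq_iff)
  then show ?thesis by (simp add: conj_set_def)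
qed

end

theory Submission
  imports Defs
begin

text \<open>
  Write \<open>tr\<close> for the normalised trace, so that \<open>E(a) = tr(a) 1\<close>, and let \<open>h = diag(1, -1)\<close>. The
  algebra \<open>u \<Delta> u\<^sup>*\<close> is spanned by \<open>1\<close> and the self-adjoint unitary \<open>h\<^sub>u = u h u\<^sup>*\<close>, which are
  orthonormal for \<open>tr(a\<^sup>*b)\<close>. Hence the difference of the Jones projections of \<open>u \<Delta> u\<^sup>*\<close> and of the
  scalars is the rank-one projection \<open>a \<mapsto> tr(h\<^sub>u a) h\<^sub>u\<close>, that is, \<open>h\<^sub>u e\<^sub>B h\<^sub>u\<close>
  (\<open>diag_expectation_minus_tr\<close>).

  For self-adjoint \<open>x\<close> and \<open>y\<close> the product of \<open>x e\<^sub>B x\<close> and \<open>y e\<^sub>B y\<close> is \<open>tr(xy) x e\<^sub>B y\<close>; since the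
  index is \<open>4\<close>, the dual expectation sends it to \<open>tr(xy) xy / 4\<close> (\<open>A1_ip_rank_one\<close>). If \<open>x\<close> and
  \<open>y\<close> are also unitary, then so is \<open>xy\<close>, and this matrix has norm \<open>|tr(xy)| / 4\<close>, which is \<open>1/4\<close>
  for \<open>x = y\<close>. Therefore the cosine of the angle is \<open>|tr(h h\<^sub>u)|\<close> (\<open>interior_angle_conj_Delta\<close>).

  If the first row of \<open>u\<close> is \<open>(p, q)\<close>, this number is \<open>||p|\<^sup>2 - |q|\<^sup>2|\<close> with \<open>|p|\<^sup>2 + |q|\<^sup>2 = 1\<close>. It
  lies in \<open>[0, 1]\<close>, and the rotation by \<open>t / 2\<close> makes it \<open>|cos t|\<close>, so every angle \<open>t\<close> in
  \<open>[0, \<pi>/2]\<close> occurs.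
\<close>

section \<open>The operator norm of multiples of unitaries\<close>

lemma mat_mult_cscale: "mat c ** a = cscale c a" "a ** mat c = cscale c (a :: 'n::finite cmat)"
proof -
  have "mat c = cscale c (mat 1 :: 'n cmat)"
    by (simp add: mat_def cscale_def vec_eq_iff)
  then show "mat c ** a = cscale c a" "a ** mat c = cscale c a"
    by (simp_all add: cmat_cscale)
qed

lemma inner_dagger:
  fixes a :: "'n::finite cmat"
  shows "(a *v v) \<bullet> w = v \<bullet> (dagger a *v w)"
proof -
  have "(a *v v) \<bullet> w = (\<Sum>i\<in>UNIV. \<Sum>j\<in>UNIV. (a $ i $ j * v $ j) \<bullet> (w $ i))"
    by (simp add: inner_vec_def matrix_vector_mult_def inner_sum_left)
  also have "\<dots> = (\<Sum>i\<in>UNIV. \<Sum>j\<in>UNIV. (v $ j) \<bullet> (cnj (a $ i $ j) * w $ i))"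
    by (intro sum.cong refl) (simp add: inner_complex_def algebra_simps)
  also have "\<dots> = (\<Sum>j\<in>UNIV. \<Sum>i\<in>UNIV. (v $ j) \<bullet> (cnj (a $ i $ j) * w $ i))"
    by (rule sum.swap)
  also have "\<dots> = v \<bullet> (dagger a *v w)"
    by (simp add: inner_vec_def matrix_vector_mult_def inner_sum_right dagger_def)
  finally show ?thesis .
qed

lemma norm_unitary_mult:
  fixes a :: "'n::finite cmat"
  assumes "dagger a ** a = mat 1"
  shows "norm (a *v v) = norm v"
  by (simp add: norm_eq_sqrt_inner inner_dagger matrix_vector_mul_assoc assms)

lemma opnorm_cscale_unitary:
  fixes a :: "'n::finite cmat"
  assumes "dagger a ** a = mat 1"
  shows "opnorm (cscale c a) = cmod c"
proof -
  have "cscale c a *v v = (\<chi> i. c * (a *v v) $ i)" for v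
    by (simp add: cscale_def matrix_vector_mult_def vec_eq_iff sum_distrib_left mult.assoc)
  moreover have "norm (\<chi> i. c * w $ i) = cmod c * norm w" for w :: "complex^'n"
    by (simp add: norm_vec_def norm_mult L2_set_right_distrib)
  ultimately have norm: "norm (cscale c a *v v) = cmod c * norm v" for v
    by (simp add: norm_unitary_mult[OF assms])
  show ?thesis
    unfolding opnorm_def
  proof (rule antisym)
    show "onorm (\<lambda>v. cscale c a *v v) \<le> cmod c"
      by (rule onorm_le) (simp add: norm)
    have "norm (cscale c a *v 1) / norm (1 :: complex^'n) \<le> onorm (\<lambda>v. cscale c a *v v)"
      by (rule le_onorm) (rule matrix_vector_mul_bounded_linear)
    moreover have "(1 :: complex^'n) \<noteq> 0"
      by (simp add: vec_eq_iff)
    ultimately show "cmod c \<le> onorm (\<lambda>v. cscale c a *v v)"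
      by (simp add: norm)
  qed
qed

section \<open>The basic construction of the trace\<close>

definition ntr :: "2 cmat \<Rightarrow> complex" where
  "ntr a = (a $ 1 $ 1 + a $ 2 $ 2) / 2"

lemma tr_expectation_ntr: "tr_expectation a = mat (ntr a)"
  by (simp add: tr_expectation_def ntr_def)

lemma ntr_commute: "ntr (a ** b) = ntr (b ** a)"
  by (simp add: ntr_def matrix_matrix_mult_def sum_2 algebra_simps)

lemma ntr_mat [simp]: "ntr (mat c) = c"
  by (simp add: ntr_def mat_def)

lemma ntr_cscale: "ntr (cscale c a) = c * ntr a"
  by (simp add: ntr_def cscale_def algebra_simps)

lemma ntr_mult_diff: "ntr ((a :: 2 cmat) ** (b - c)) = ntr (a ** b) - ntr (a ** c)"
  by (simp add: ntr_def matrix_matrix_mult_def sum_2 field_simps)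

lemma ntr_dagger: "ntr (dagger a) = cnj (ntr a)"
  by (simp add: ntr_def dagger_def)

lemma rank_one_span_op: "(\<lambda>a. x ** E (y ** a)) = span_op E [(x, y)]"
  by (simp add: span_op_def fun_eq_iff)

text \<open>A quasi-basis also represents the identity operator, by the pairs \<open>(l, l\<^sup>*)\<close>; since the sum of
  the products \<open>xy\<close> depends on the operator alone, any other representation gives the index too.\<close>

lemma watatani_index_span_op_id:
  assumes "finite_index E" "span_op E xys = id"
  shows "watatani_index E = (\<Sum>(x, y)\<leftarrow>xys. x ** y)"
proof -
  obtain \<Lambda> where \<Lambda>: "quasi_basis E \<Lambda>"
    using assms(1) by (auto simp: finite_index_def)
  show ?thesis
    using watatani_index_eq[OF \<Lambda>] span_op_quasi_basis[OF \<Lambda>, of xys] by (simp add: assms(2))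
qed

text \<open>The identity and the three Pauli matrices are an orthonormal basis of self-adjoint unitaries, so
  each of them contributes its square \<open>1\<close> to the index.\<close>

lemma watatani_index_tr: "watatani_index tr_expectation = mat 4"
proof -
  define x :: "2 cmat" where "x = vector [vector [0, 1], vector [1, 0]]"
  define y :: "2 cmat" where "y = vector [vector [0, - \<i>], vector [\<i>, 0]]"
  define z :: "2 cmat" where "z = diag2 1 (-1)"
  have "span_op tr_expectation [(mat 1, mat 1), (x, x), (y, y), (z, z)] a = a" for a
    by (simp add: span_op_def x_def y_def z_def diag2_def tr_expectation_def mat_def
        matrix_matrix_mult_def vec_eq_iff forall_2 sum_2 field_simps)
  then have "watatani_index tr_expectation = mat 1 ** mat 1 + x ** x + y ** y + z ** z"
    by (subst watatani_index_span_op_id[OF tr_finite_index,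
          where xys = "[(mat 1, mat 1), (x, x), (y, y), (z, z)]"])
      (simp_all add: fun_eq_iff add.assoc)
  also have "\<dots> = mat 4"
    by (simp add: x_def y_def z_def diag2_def mat_def matrix_matrix_mult_def vec_eq_iff forall_2 sum_2)
  finally show ?thesis .
qed

lemma dual_expectation_tr_rank_one:
  "dual_expectation tr_expectation (\<lambda>a. x ** tr_expectation (y ** a)) = cscale (1/4) (x ** y)"
proof -
  have mat: "mat 4 ** mat (1/4) = (mat 1 :: 2 cmat)" "mat (1/4) ** mat 4 = (mat 1 :: 2 cmat)"
    by (simp_all add: mat_def matrix_matrix_mult_def vec_eq_iff forall_2 sum_2)
  then have "mat 4 ** matrix_inv (mat 4 :: 2 cmat) = mat 1"
    unfolding matrix_inv_def by (metis (mono_tags, lifting) someI_ex)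
  then have "matrix_inv (mat 4 :: 2 cmat) = mat (1/4)"
    by (metis mat(2) matrix_mul_assoc matrix_mul_lid matrix_mul_rid)
  then show ?thesis
    by (simp add: rank_one_span_op dual_expectation_span_op[OF tr_finite_index] watatani_index_tr
        mat_mult_cscale)
qed

text \<open>Faithfulness of the trace makes an adjoint unique.\<close>

lemma module_adj_tr_eq:
  assumes adj: "\<And>a b. module_ip tr_expectation (T a) b = module_ip tr_expectation a (S b)"
  shows "module_adj tr_expectation T = S"
  unfolding module_adj_def
proof (rule the_equality)
  fix S' assume S': "\<forall>a b. module_ip tr_expectation (T a) b = module_ip tr_expectation a (S' b)"
  show "S' = S"
  proof
    fix b
    let ?d = "S' b - S b"
    have "module_ip tr_expectation ?d (S' b) = module_ip tr_expectation ?d (S b)"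
      using adj S' by presburger
    then have "ntr (dagger ?d ** S' b) = ntr (dagger ?d ** S b)"
      unfolding module_ip_def tr_expectation_ntr using ntr_mat by metis
    then have "tr_expectation (dagger ?d ** ?d) = 0"
      by (simp add: tr_expectation_ntr ntr_mult_diff)
    then have "?d = 0"
      by (rule tr_faithful)
    then show "S' b = S b" by simp
  qed
qed (use adj in blast)

lemma module_adj_rank_one:
  assumes "dagger h = h"
  shows "module_adj tr_expectation (\<lambda>a. h ** tr_expectation (h ** a)) = (\<lambda>a. h ** tr_expectation (h ** a))"
proof (rule module_adj_tr_eq)
  fix a b
  have "cnj (ntr (h ** a)) = ntr (dagger a ** h)"
    by (metis assms dagger_mult ntr_dagger)
  then show "module_ip tr_expectation (h ** tr_expectation (h ** a)) b =
             module_ip tr_expectation a (h ** tr_expectation (h ** b))"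
    by (simp add: module_ip_def tr_expectation_ntr mat_mult_cscale dagger_cscale assms
        cmat_cscale ntr_cscale mult.commute)
qed

text \<open>By the relation \<open>e\<^sub>B x e\<^sub>B = E(x) e\<^sub>B\<close>, the product \<open>hk\<close> between the two factors \<open>e\<^sub>B\<close> collapses
  to its trace.\<close>

lemma A1_ip_rank_one:
  assumes "dagger h = h"
  shows "A1_ip tr_expectation (\<lambda>a. h ** tr_expectation (h ** a)) (\<lambda>a. k ** tr_expectation (k ** a)) =
         cscale (ntr (h ** k) / 4) (h ** k)"
proof -
  have cscale_cscale: "cscale c (cscale d x) = cscale (c * d) x" for c d and x :: "2 cmat"
    by (simp add: cscale_def vec_eq_iff)
  have "(\<lambda>a. h ** tr_expectation (h ** a)) \<circ> (\<lambda>a. k ** tr_expectation (k ** a)) =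
        (\<lambda>a. cscale (ntr (h ** k)) h ** tr_expectation (k ** a))"
    by (simp add: fun_eq_iff tr_expectation_ntr mat_mult_cscale cmat_cscale ntr_cscale cscale_cscale
        mult.commute)
  then show ?thesis
    unfolding A1_ip_def module_adj_rank_one[OF assms]
    by (simp only: dual_expectation_tr_rank_one) (simp add: cmat_cscale cscale_cscale)
qed

section \<open>The angle between two conjugates of the diagonal\<close>

text \<open>Conjugating by \<open>u\<close> reduces this to \<open>diag(b\<^sub>1\<^sub>1, b\<^sub>2\<^sub>2) = tr(b) 1 + tr(gb) g\<close> for
  \<open>g = diag(1, -1)\<close> and \<open>b = u\<^sup>*au\<close>, the expansion of a diagonal in the orthonormal pair \<open>1, g\<close>.\<close>

lemma diag_expectation_minus_tr:
  assumes "u \<in> unitary_mats"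
  defines "h \<equiv> u ** diag2 1 (-1) ** dagger u"
  shows "diag_expectation u a - tr_expectation a = h ** tr_expectation (h ** a)"
proof -
  have u: "dagger u ** u = mat 1" "u ** dagger u = mat 1"
    using assms by (auto simp: unitary_mats_def)
  define b where "b = dagger u ** a ** u"
  define g where "g = diag2 1 (-1)"
  have tr_b: "ntr b = ntr a"
    by (metis b_def ntr_commute matrix_mul_assoc matrix_mul_lid u(2))
  have tr_gb: "ntr (g ** b) = ntr (h ** a)"
    by (metis b_def g_def h_def ntr_commute matrix_mul_assoc)
  have "diag2 (b $ 1 $ 1) (b $ 2 $ 2) = cscale (ntr b) (mat 1) + cscale (ntr (g ** b)) g"
    by (simp add: g_def diag2_def ntr_def mat_def cscale_def matrix_matrix_mult_def vec_eq_iff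
        forall_2 sum_2 field_simps)
  then have "diag_expectation u a = u ** (cscale (ntr a) (mat 1) + cscale (ntr (h ** a)) g) ** dagger u"
    by (simp add: diag_expectation_def Let_def flip: b_def) (simp only: tr_b tr_gb)
  also have "\<dots> = cscale (ntr a) (mat 1) + cscale (ntr (h ** a)) h"
    by (simp add: cmat_add_right matrix_add_ldistrib cmat_cscale u h_def g_def)
  also have "cscale (ntr a) (mat 1) = tr_expectation a"
    by (simp add: tr_expectation_ntr flip: mat_mult_cscale)
  finally show ?thesis
    by (simp add: tr_expectation_ntr mat_mult_cscale)
qed

lemma conj_reflection:
  assumes "u \<in> unitary_mats"
  defines "h \<equiv> u ** diag2 1 (-1) ** dagger u"
  shows "dagger h = h" "h ** h = mat 1"
proof -
  have u: "dagger u ** u = mat 1" "u ** dagger u = mat 1"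
    using assms by (auto simp: unitary_mats_def)
  have g: "dagger (diag2 1 (-1)) = diag2 1 (-1)" "diag2 1 (-1) ** diag2 1 (-1) = mat 1"
    by (simp_all add: diag2_def dagger_def mat_def matrix_matrix_mult_def vec_eq_iff forall_2 sum_2)
  show "dagger h = h"
    by (simp add: h_def dagger_mult g matrix_mul_assoc)
  show "h ** h = mat 1"
    unfolding h_def by (metis g(2) u matrix_mul_assoc matrix_mul_rid)
qed

text \<open>A product of self-adjoint unitaries is unitary, so only the scalar factors of the inner products
  survive in the norms; for the two norms in the denominator that factor is \<open>tr(1) / 4\<close>.\<close>

lemma interior_angle_conj_Delta:
  assumes v: "v \<in> unitary_mats" and u: "u \<in> unitary_mats"
  defines "h \<equiv> v ** diag2 1 (-1) ** dagger v" and "k \<equiv> u ** diag2 1 (-1) ** dagger u"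
  shows "interior_angle tr_expectation (conj_set v Delta) (conj_set u Delta) = arccos (cmod (ntr (h ** k)))"
proof -
  note h = conj_reflection[OF v, folded h_def] and k = conj_reflection[OF u, folded k_def]
  have opnorm: "opnorm (A1_ip tr_expectation (\<lambda>a. x ** tr_expectation (x ** a))
                  (\<lambda>a. y ** tr_expectation (y ** a))) = cmod (ntr (x ** y)) / 4"
    if x: "dagger x = x" "x ** x = mat 1" and y: "dagger y = y" "y ** y = mat 1" for x y
  proof -
    have "dagger (x ** y) ** (x ** y) = mat 1"
      by (metis x y dagger_mult matrix_mul_assoc matrix_mul_rid)
    then show ?thesis
      by (simp add: A1_ip_rank_one[OF x(1)] opnorm_cscale_unitary norm_divide)
  qed
  have "interior_angle tr_expectation (conj_set v Delta) (conj_set u Delta) =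
        arccos (cmod (ntr (h ** k)) / 4 / (sqrt (1 / 4) * sqrt (1 / 4)))"
    unfolding interior_angle_def Let_def A1_norm_def jones_projection_conj_Delta[OF v]
      jones_projection_conj_Delta[OF u] diag_expectation_minus_tr[OF v, folded h_def]
      diag_expectation_minus_tr[OF u, folded k_def] opnorm[OF h k] opnorm[OF h h] opnorm[OF k k]
    by (simp add: h k)
  then show ?thesis
    by simp
qed

text \<open>Unitarity makes \<open>(|p|\<^sup>2, |q|\<^sup>2)\<close> and the corresponding numbers of the second row mirror images
  of each other, so the first row determines the trace.\<close>

lemma ntr_reflections:
  assumes "u \<in> unitary_mats"
  shows "ntr (diag2 1 (-1) ** (u ** diag2 1 (-1) ** dagger u)) =
         of_real ((cmod (u $ 1 $ 1))\<^sup>2 - (cmod (u $ 1 $ 2))\<^sup>2)"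
    and "(cmod (u $ 1 $ 1))\<^sup>2 + (cmod (u $ 1 $ 2))\<^sup>2 = 1"
proof -
  define n where "n i j = (cmod (u $ i $ j))\<^sup>2" for i j
  have n: "u $ i $ j * cnj (u $ i $ j) = of_real (n i j)" "cnj (u $ i $ j) * u $ i $ j = of_real (n i j)" for i j
    by (simp_all add: n_def complex_norm_square mult.commute del: of_real_power)
  have u: "(dagger u ** u) $ i $ j = mat 1 $ i $ j" "(u ** dagger u) $ i $ j = mat 1 $ i $ j" for i j
    using assms by (auto simp: unitary_mats_def)
  have "complex_of_real (n 1 1 + n 1 2) = of_real 1" "complex_of_real (n 1 1 + n 2 1) = of_real 1"
    "complex_of_real (n 2 1 + n 2 2) = of_real 1"
    using u(2)[of 1 1] u(1)[of 1 1] u(2)[of 2 2]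
    by (simp_all add: dagger_def mat_def matrix_matrix_mult_def sum_2 n)
  then have rel: "n 1 1 + n 1 2 = 1" "n 1 1 + n 2 1 = 1" "n 2 1 + n 2 2 = 1"
    by (simp_all only: of_real_eq_iff)
  then show "(cmod (u $ 1 $ 1))\<^sup>2 + (cmod (u $ 1 $ 2))\<^sup>2 = 1"
    by (simp add: n_def)
  have "ntr (diag2 1 (-1) ** (u ** diag2 1 (-1) ** dagger u)) =
        of_real ((n 1 1 - n 1 2 - n 2 1 + n 2 2) / 2)"
    by (simp add: ntr_def diag2_def dagger_def matrix_matrix_mult_def sum_2 n)
  also have "(n 1 1 - n 1 2 - n 2 1 + n 2 2) / 2 = n 1 1 - n 1 2"
    using rel by simp
  finally show "ntr (diag2 1 (-1) ** (u ** diag2 1 (-1) ** dagger u)) =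
      of_real ((cmod (u $ 1 $ 1))\<^sup>2 - (cmod (u $ 1 $ 2))\<^sup>2)"
    by (simp only: n_def)
qed

lemma interior_angle_Delta_conj:
  assumes "u \<in> unitary_mats"
  shows "interior_angle tr_expectation Delta (conj_set u Delta) =
         arccos \<bar>(cmod (u $ 1 $ 1))\<^sup>2 - (cmod (u $ 1 $ 2))\<^sup>2\<bar>"
proof -
  have one: "dagger (mat 1) = (mat 1 :: 2 cmat)"
    by (simp add: dagger_def mat_def vec_eq_iff)
  then have "mat 1 \<in> (unitary_mats :: 2 cmat set)"
    by (simp add: unitary_mats_def)
  from interior_angle_conj_Delta[OF this assms] show ?thesis
    by (simp add: conj_set_one one ntr_reflections(1)[OF assms] del: of_real_diff of_real_power)
qed

definition rotation2 :: "real \<Rightarrow> 2 cmat" where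
  "rotation2 t = vector [vector [of_real (cos t), of_real (- sin t)],
                         vector [of_real (sin t), of_real (cos t)]]"

lemma rotation2_unitary: "rotation2 t \<in> unitary_mats"
proof -
  have "complex_of_real (cos t) * of_real (cos t) + of_real (sin t) * of_real (sin t) = 1"
    by (metis of_real_1 of_real_add of_real_mult sin_cos_squared_add3)
  then show ?thesis
    by (simp add: unitary_mats_def rotation2_def dagger_def mat_def matrix_matrix_mult_def
        vec_eq_iff forall_2 sum_2 add.commute mult.commute del: of_real_mult of_real_add)
qed

theorem corollary4p6:
  shows "{interior_angle tr_expectation Delta (conj_set u Delta) | u. u \<in> unitary_mats} = {0..pi/2}"
proof (intro equalityI subsetI)
  fix t
  assume "t \<in> {interior_angle tr_expectation Delta (conj_set u Delta) | u. u \<in> unitary_mats}"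
  then obtain u :: "2 cmat" where u: "u \<in> unitary_mats"
    and t: "t = arccos \<bar>(cmod (u $ 1 $ 1))\<^sup>2 - (cmod (u $ 1 $ 2))\<^sup>2\<bar>"
    using interior_angle_Delta_conj by blast
  have "\<bar>(cmod (u $ 1 $ 1))\<^sup>2 - (cmod (u $ 1 $ 2))\<^sup>2\<bar> \<le> 1"
    using ntr_reflections(2)[OF u] zero_le_power2[of "cmod (u $ 1 $ 1)"]
      zero_le_power2[of "cmod (u $ 1 $ 2)"] by linarith
  then show "t \<in> {0..pi/2}"
    unfolding t using arccos_lbound arccos_le_pi2 by force
next
  fix t assume t: "t \<in> {0..pi/2}"
  have "(cos (t/2))\<^sup>2 - (sin (t/2))\<^sup>2 = cos t"
    using cos_double[of "t/2"] by simp
  moreover have "0 \<le> cos t"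
    using t by (intro cos_ge_zero) auto
  moreover have "cmod (rotation2 (t/2) $ 1 $ 1) = \<bar>cos (t/2)\<bar>" "cmod (rotation2 (t/2) $ 1 $ 2) = \<bar>sin (t/2)\<bar>"
    by (simp_all add: rotation2_def)
  ultimately have "interior_angle tr_expectation Delta (conj_set (rotation2 (t/2)) Delta) = arccos (cos t)"
    by (simp add: interior_angle_Delta_conj[OF rotation2_unitary])
  also have "\<dots> = t"
    using t by (intro arccos_cos) auto
  finally show "t \<in> {interior_angle tr_expectation Delta (conj_set u Delta) | u. u \<in> unitary_mats}"
    using rotation2_unitary by (intro CollectI exI[of _ "rotation2 (t/2)"]) simp
qed

end
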